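(* For all integers $k\ge 6$ and $m\ge 2$, \[ \operatorname{R}^{\sharp}_k(\mathcal{B}\,|\,B_m)\le\left(\operatorname{R}^{\sharp}_{\lfloor k/2\rfloor}(\mathcal{B}\,|\,B_m)-2\right)\operatorname{R}^{\sharp}_{\lceil k/2\rceil}(\mathcal{B}\,|\,B_m)+\operatorname{R}^{\sharp}_{\lfloor k/2\rfloor}(\mathcal{B}\,|\,B_m). \]
   Context: $B_n$ is the Boolean lattice of subsets of $[n]=\{1,\dots,n\}$ ordered by inclusion. An induced copy of $B_m$ in $B_N$ is the image of an injection $f:B_m\to B_N$ with $f(x)\subseteq f(y)$ iff $x\subseteq y$. $\operatorname{R}^{\sharp}_k(\mathcal{B}\,|\,B_m)$ is the smallest $N$ such that for every assignment of one of $k$ colors to each element of $B_N$ there is an induced copy of $B_m$ all of whose elements have the same color. *)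

theory Defs
  imports Complex_Main
begin

definition boolean_lattice :: "nat \<Rightarrow> nat set set" where
  "boolean_lattice n = Pow {1..n}"

definition induced_copy :: "nat \<Rightarrow> nat \<Rightarrow> nat set set \<Rightarrow> bool" where
  "induced_copy m N C \<longleftrightarrow>
     (\<exists>f. f ` boolean_lattice m \<subseteq> boolean_lattice N \<and>
          inj_on f (boolean_lattice m) \<and>
          (\<forall>x\<in>boolean_lattice m. \<forall>y\<in>boolean_lattice m. f x \<subseteq> f y \<longleftrightarrow> x \<subseteq> y) \<and>
          C = f ` boolean_lattice m)"

definition boolean_ramsey_property :: "nat \<Rightarrow> nat \<Rightarrow> nat \<Rightarrow> bool" where
  "boolean_ramsey_property k m N \<longleftrightarrow>
     (\<forall>c :: nat set \<Rightarrow> nat.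
        c ` boolean_lattice N \<subseteq> {1..k} \<longrightarrow>
        (\<exists>C. induced_copy m N C \<and> (\<exists>i. \<forall>x\<in>C. c x = i)))"

text \<open>For \<open>k \<ge> 1\<close> the set of admissible \<open>N\<close> is nonempty by the finite Ramsey theorem for
  Boolean lattices, so the minimum below is attained.\<close>

definition boolean_ramsey :: "nat \<Rightarrow> nat \<Rightarrow> nat" where
  "boolean_ramsey k m = (LEAST N. boolean_ramsey_property k m N)"

end

theory Submission
  imports Defs
begin

text \<open>
  Split the \<open>k\<close> colours into a group \<open>K\<^sub>1\<close> of size \<open>a = \<lfloor>k/2\<rfloor>\<close> and a group \<open>K\<^sub>2\<close> of size
  \<open>b = \<lceil>k/2\<rceil>\<close>, and write \<open>A\<close>, \<open>B\<close> for the corresponding Ramsey numbers. The ground set is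
  \<open>X \<union> Z\<close> with \<open>card X = A\<close>, and \<open>Z\<close> carries an increasing filtration \<open>F\<close>. A set \<open>S \<subseteq> X\<close> is
  sent to \<open>S \<union> T\<close> with \<open>F (card S) \<subseteq> T \<subseteq> F (card S + 1)\<close>, which always gives an embedding of the
  subsets of \<open>X\<close>. If each \<open>T\<close> can be chosen so that the colour of \<open>S \<union> T\<close> lies in \<open>K\<^sub>1\<close>, the
  definition of \<open>A\<close> applies; otherwise some cube of dimension \<open>B\<close> only has colours in \<open>K\<^sub>2\<close>.

  Using a block of size \<open>B\<close> on each of the \<open>A + 1\<close> levels of \<open>X\<close> costs \<open>(A + 1) * B\<close>. Three
  levels are free because \<open>a \<ge> 3\<close>: put the colours of the empty set and of the full set into
  \<open>K\<^sub>1\<close>, together with a third colour such that at least \<open>A\<close> singletons have their colours in \<open>K\<^sub>1\<close>,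
  and take \<open>X\<close> among these singletons. So the levels 0, 1 and \<open>A\<close> need no block.
\<close>

section \<open>Monochromatic copies inside an arbitrary ground set\<close>

text \<open>Ground set and colours have free types, so that subsets such as \<open>X\<close> or a
  block of \<open>Z\<close> can host copies directly. Order reflection makes \<open>f\<close>
  injective.\<close>

definition mono_copy :: "('a set \<Rightarrow> 'c) \<Rightarrow> nat \<Rightarrow> 'a set \<Rightarrow> bool" where
  "mono_copy c m W \<longleftrightarrow>
     (\<exists>f i. (\<forall>x\<in>boolean_lattice m. f x \<subseteq> W \<and> c (f x) = i) \<and>
            (\<forall>x\<in>boolean_lattice m. \<forall>y\<in>boolean_lattice m. f x \<subseteq> f y \<longleftrightarrow> x \<subseteq> y))"

lemma mono_copy_transfer:
  assumes "mono_copy (\<lambda>S. c (g S)) m X"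
    and "\<And>S. S \<subseteq> X \<Longrightarrow> g S \<subseteq> W"
    and "\<And>S T. S \<subseteq> X \<Longrightarrow> T \<subseteq> X \<Longrightarrow> g S \<subseteq> g T \<longleftrightarrow> S \<subseteq> T"
  shows "mono_copy c m W"
proof -
  obtain f i where f: "\<forall>x\<in>boolean_lattice m. f x \<subseteq> X \<and> c (g (f x)) = i"
    "\<forall>x\<in>boolean_lattice m. \<forall>y\<in>boolean_lattice m. f x \<subseteq> f y \<longleftrightarrow> x \<subseteq> y"
    using assms(1) unfolding mono_copy_def by blast
  have "g (f x) \<subseteq> W \<and> c (g (f x)) = i" if "x \<in> boolean_lattice m" for x
    using bspec[OF f(1) that] assms(2) by simp
  moreover have "g (f x) \<subseteq> g (f y) \<longleftrightarrow> x \<subseteq> y"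
    if "x \<in> boolean_lattice m" "y \<in> boolean_lattice m" for x y
    using assms(3)[of "f x" "f y"] f that by simp
  ultimately show ?thesis
    unfolding mono_copy_def by (intro exI[of _ "\<lambda>x. g (f x)"] exI[of _ i]) blast
qed

lemma boolean_ramsey_property_iff:
  "boolean_ramsey_property k m N \<longleftrightarrow>
     (\<forall>c :: nat set \<Rightarrow> nat. c ` Pow {1..N} \<subseteq> {1..k} \<longrightarrow> mono_copy c m {1..N})"
proof -
  have "(\<exists>C. induced_copy m N C \<and> (\<exists>i. \<forall>x\<in>C. c x = i)) \<longleftrightarrow> mono_copy c m {1..N}"
    for c :: "nat set \<Rightarrow> nat"
  proof
    assume "\<exists>C. induced_copy m N C \<and> (\<exists>i. \<forall>x\<in>C. c x = i)"
    then obtain C i where "induced_copy m N C" and C: "\<forall>x\<in>C. c x = i"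
      by blast
    then obtain f where f: "f ` boolean_lattice m \<subseteq> Pow {1..N}" "C = f ` boolean_lattice m"
      "\<forall>x\<in>boolean_lattice m. \<forall>y\<in>boolean_lattice m. f x \<subseteq> f y \<longleftrightarrow> x \<subseteq> y"
      unfolding induced_copy_def boolean_lattice_def[of N] by blast
    have "\<forall>x\<in>boolean_lattice m. f x \<subseteq> {1..N} \<and> c (f x) = i"
      using f(1,2) C by blast
    with f(3) show "mono_copy c m {1..N}"
      unfolding mono_copy_def by (intro exI[of _ f] exI[of _ i] conjI)
  next
    assume "mono_copy c m {1..N}"
    then obtain f i where f: "\<forall>x\<in>boolean_lattice m. f x \<subseteq> {1..N} \<and> c (f x) = i"
      "\<forall>x\<in>boolean_lattice m. \<forall>y\<in>boolean_lattice m. f x \<subseteq> f y \<longleftrightarrow> x \<subseteq> y"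
      unfolding mono_copy_def by blast
    have "inj_on f (boolean_lattice m)"
      using f(2) by (intro inj_onI equalityI) auto
    with f have "induced_copy m N (f ` boolean_lattice m)"
      unfolding induced_copy_def boolean_lattice_def[of N]
      by (intro exI[of _ f] conjI image_subsetI) simp_all
    moreover have "\<forall>x\<in>f ` boolean_lattice m. c x = i"
      using f(1) by simp
    ultimately show "\<exists>C. induced_copy m N C \<and> (\<exists>i. \<forall>x\<in>C. c x = i)"
      by blast
  qed
  then show ?thesis
    unfolding boolean_ramsey_property_def boolean_lattice_def[of N] by simp
qed

text \<open>The ground set is numbered by a bijection \<open>e\<close>, and the at most
  \<open>k\<close> colours are renamed into \<open>{1..k}\<close> by an injection
  \<open>d\<close>.\<close>

lemma mono_copy_if_ramsey:
  fixes c :: "'a set \<Rightarrow> 'c"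
  assumes ramsey: "boolean_ramsey_property k m N"
    and W: "finite W" "card W = N"
    and K: "finite K" "card K \<le> k" "c ` Pow W \<subseteq> K"
  shows "mono_copy c m W"
proof -
  obtain e where e: "bij_betw e {1..N} W"
    using W by (metis ex_bij_betw_nat_finite_1)
  obtain d where d: "inj_on d K" "d ` K \<subseteq> {1..k}"
    using K card_le_inj[of K "{1..k}"] by auto
  have sub: "e ` S \<subseteq> W" if "S \<subseteq> {1..N}" for S
    using e that unfolding bij_betw_def by blast
  have "d (c (e ` S)) \<in> {1..k}" if "S \<subseteq> {1..N}" for S
    using d(2) K(3) sub[OF that] by blast
  then have "(\<lambda>S. d (c (e ` S))) ` Pow {1..N} \<subseteq> {1..k}"
    by blast
  with ramsey have "mono_copy (\<lambda>S. d (c (e ` S))) m {1..N}"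
    unfolding boolean_ramsey_property_iff by simp
  then have "mono_copy (\<lambda>T. d (c T)) m W"
  proof (rule mono_copy_transfer[where g = "\<lambda>S. e ` S"])
    show "e ` S \<subseteq> e ` T \<longleftrightarrow> S \<subseteq> T" if "S \<subseteq> {1..N}" "T \<subseteq> {1..N}" for S T
      using e that inj_on_image_mem_iff[of e "{1..N}" _ T] unfolding bij_betw_def by blast
  qed (rule sub)
  then obtain f i where f: "\<forall>x\<in>boolean_lattice m. f x \<subseteq> W \<and> d (c (f x)) = i"
    "\<forall>x\<in>boolean_lattice m. \<forall>y\<in>boolean_lattice m. f x \<subseteq> f y \<longleftrightarrow> x \<subseteq> y"
    unfolding mono_copy_def by blast
  \<comment> \<open>Since \<open>d\<close> is injective on \<open>K\<close>, constancy of the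
    renamed colour gives constancy of \<open>c\<close>; the image of the bottom element serves as
    reference.\<close>
  have "c (f x) = c (f {})" if "x \<in> boolean_lattice m" for x
  proof -
    have bot: "{} \<in> boolean_lattice m"
      by (simp add: boolean_lattice_def)
    have "c (f x) \<in> K" "c (f {}) \<in> K"
      using bspec[OF f(1) that] bspec[OF f(1) bot] K(3) by blast+
    moreover have "d (c (f x)) = d (c (f {}))"
      using bspec[OF f(1) that] bspec[OF f(1) bot] by simp
    ultimately show ?thesis
      using d(1) by (simp add: inj_on_def)
  qed
  then have "\<forall>x\<in>boolean_lattice m. f x \<subseteq> W \<and> c (f x) = c (f {})"
    using f(1) by blast
  with f(2) show ?thesis
    unfolding mono_copy_def by (intro exI[of _ f] exI[of _ "c (f {})"] conjI)
qed

section \<open>Embedding along a filtration\<close>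

text \<open>A level is paid for either by a block of size \<open>B\<close> or by a known colour in
  \<open>K1\<close>. If all admissible \<open>T\<close> over some \<open>S\<close> fail, then so
  does \<open>T = F (card S)\<close>, which leaves the block, and there a cube coloured by
  \<open>K2\<close>.\<close>

lemma mono_copy_filtration:
  fixes c :: "'a set \<Rightarrow> 'c" and F :: "nat \<Rightarrow> 'a set"
  assumes ramsey: "boolean_ramsey_property a m A" "boolean_ramsey_property b m B"
    and X: "finite X" "card X = A" and Z: "finite Z" "X \<inter> Z = {}"
    and K1: "finite K1" "card K1 \<le> a" and K2: "finite K2" "card K2 \<le> b"
    and col: "c ` Pow (X \<union> Z) \<subseteq> K1 \<union> K2"
    and F: "mono F" "\<And>i. F i \<subseteq> Z"
    and level: "\<And>S. S \<subseteq> X \<Longrightarrow>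
      B \<le> card (F (Suc (card S)) - F (card S)) \<or> c (S \<union> F (card S)) \<in> K1"
  shows "mono_copy c m (X \<union> Z)"
proof (cases "\<exists>S\<subseteq>X. \<forall>T. F (card S) \<subseteq> T \<and> T \<subseteq> F (Suc (card S)) \<longrightarrow> c (S \<union> T) \<notin> K1")
  case True
  then obtain S where S: "S \<subseteq> X"
    and none: "\<forall>T. F (card S) \<subseteq> T \<and> T \<subseteq> F (Suc (card S)) \<longrightarrow> c (S \<union> T) \<notin> K1"
    by (elim exE conjE)
  have F_Suc: "F (card S) \<subseteq> F (Suc (card S))"
    using F(1) by (simp add: monoD)
  then have "B \<le> card (F (Suc (card S)) - F (card S))"
    using level[OF S] none by simp
  then obtain U where U: "U \<subseteq> F (Suc (card S)) - F (card S)" "card U = B" "finite U"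
    by (rule obtain_subset_with_card_n)
  let ?g = "\<lambda>T. S \<union> F (card S) \<union> T"
  have "c (?g T) \<in> K2" if "T \<subseteq> U" for T
  proof -
    have "c (?g T) \<notin> K1"
      using none[rule_format, of "F (card S) \<union> T"] that U(1) F_Suc unfolding Un_assoc by blast
    moreover have "?g T \<subseteq> X \<union> Z"
      using S that U(1) F(2) by blast
    ultimately show ?thesis
      using col by blast
  qed
  then have "mono_copy (\<lambda>T. c (?g T)) m U"
    by (intro mono_copy_if_ramsey[OF ramsey(2) U(3,2) K2] image_subsetI) simp
  then show ?thesis
  proof (rule mono_copy_transfer[where g = ?g])
    show "?g T \<subseteq> X \<union> Z" if "T \<subseteq> U" for T
      using S that U(1) F(2) by blast
    show "?g T \<subseteq> ?g T' \<longleftrightarrow> T \<subseteq> T'" if "T \<subseteq> U" "T' \<subseteq> U" for T T'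
    proof -
      have "U \<inter> (S \<union> F (card S)) = {}"
        using S U(1) F(2) Z(2) by blast
      then show ?thesis
        using that by blast
    qed
  qed
next
  case False
  then have "\<forall>S\<in>Pow X. \<exists>T. F (card S) \<subseteq> T \<and> T \<subseteq> F (Suc (card S)) \<and> c (S \<union> T) \<in> K1"
    by simp
  from bchoice[OF this] obtain t where
    "\<forall>S\<in>Pow X. F (card S) \<subseteq> t S \<and> t S \<subseteq> F (Suc (card S)) \<and> c (S \<union> t S) \<in> K1"
    ..
  then have t: "F (card S) \<subseteq> t S" "t S \<subseteq> F (Suc (card S))" "c (S \<union> t S) \<in> K1"
    if "S \<subseteq> X" for S
    using that by simp_all
  have tZ: "t S \<subseteq> Z" if "S \<subseteq> X" for S
    using t(2)[OF that] F(2) by blast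
  have "mono_copy (\<lambda>S. c (S \<union> t S)) m X"
    by (intro mono_copy_if_ramsey[OF ramsey(1) X K1] image_subsetI) (simp add: t(3))
  then show ?thesis
  proof (rule mono_copy_transfer[where g = "\<lambda>S. S \<union> t S"])
    show "S \<union> t S \<subseteq> X \<union> Z" if "S \<subseteq> X" for S
      using that tZ by blast
    show "S \<union> t S \<subseteq> S' \<union> t S' \<longleftrightarrow> S \<subseteq> S'" if "S \<subseteq> X" "S' \<subseteq> X" for S S'
    proof
      assume "S \<union> t S \<subseteq> S' \<union> t S'"
      then show "S \<subseteq> S'"
        using that tZ[of S'] Z(2) by blast
    next
      assume sub: "S \<subseteq> S'"
      show "S \<union> t S \<subseteq> S' \<union> t S'"
      \<comment> \<open>A strict inclusion raises the cardinality, so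
        \<open>F (Suc (card S))\<close> separates \<open>t S\<close> from \<open>t S'\<close>
        although they are chosen independently.\<close>
      proof (cases "S = S'")
        case False
        then have "card S < card S'"
          using sub that(2) X(1) by (meson finite_subset psubsetI psubset_card_mono)
        then have "F (Suc (card S)) \<subseteq> F (card S')"
          using F(1) by (simp add: monoD)
        then show ?thesis
          using t(2)[OF that(1)] t(1)[OF that(2)] sub by blast
      qed simp
    qed
  qed
qed

section \<open>Existence of the Ramsey numbers and a linear lower bound\<close>

lemma boolean_ramsey_property_one: "boolean_ramsey_property 1 m m"
  unfolding boolean_ramsey_property_iff
proof (intro allI impI)
  fix c :: "nat set \<Rightarrow> nat"
  assume "c ` Pow {1..m} \<subseteq> {1..1}"
  then show "mono_copy c m {1..m}"
    unfolding mono_copy_def boolean_lattice_def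
    by (intro exI[of _ id] exI[of _ 1]) auto
qed

text \<open>The version without free levels: each of the \<open>A + 1\<close> levels gets a block.
  With \<open>b = 1\<close> it drives the induction proving that Ramsey numbers exist.\<close>

lemma boolean_ramsey_property_add:
  assumes "boolean_ramsey_property a m A" "boolean_ramsey_property b m B"
  shows "boolean_ramsey_property (a + b) m (A + (A + 1) * B)"
  unfolding boolean_ramsey_property_iff
proof (intro allI impI)
  fix c :: "nat set \<Rightarrow> nat"
  let ?N = "A + (A + 1) * B"
  assume c: "c ` Pow {1..?N} \<subseteq> {1..a + b}"
  \<comment> \<open>The \<open>min\<close> keeps every \<open>F i\<close> inside the ground
    set.\<close>
  let ?F = "\<lambda>i. {A + 1..A + min i (A + 1) * B}"
  have W: "{1..A} \<union> {A + 1..?N} = {1..?N}"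
    by auto
  have K: "{1..a} \<union> {a + 1..a + b} = {1..a + b}"
    by auto
  have "mono_copy c m ({1..A} \<union> {A + 1..?N})"
  proof (rule mono_copy_filtration[OF assms, where ?F = ?F])
    show "c ` Pow ({1..A} \<union> {A + 1..?N}) \<subseteq> {1..a} \<union> {a + 1..a + b}"
      using c unfolding W K .
    show "mono ?F"
      by (intro monoI atLeastatMost_subset_iff[THEN iffD2] disjI2 conjI add_left_mono
          mult_right_mono min.mono) auto
    show "?F i \<subseteq> {A + 1..?N}" for i
      using mult_right_mono[of "min i (A + 1)" "A + 1" B] by auto
    show "B \<le> card (?F (Suc (card S)) - ?F (card S)) \<or> c (S \<union> ?F (card S)) \<in> {1..a}"
      if "S \<subseteq> {1..A}" for S
    proof -
      have "card S \<le> A"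
        using card_mono[OF _ that] by simp
      then have "?F (Suc (card S)) - ?F (card S) = {A + card S * B + 1..A + card S * B + B}"
        by auto
      then show ?thesis
        by simp
    qed
  qed auto
  then show "mono_copy c m {1..?N}"
    unfolding W .
qed

lemma boolean_ramsey_property_ex:
  assumes "k \<ge> 1"
  shows "\<exists>N. boolean_ramsey_property k m N"
  using assms
proof (induction k rule: dec_induct)
  case base
  then show ?case using boolean_ramsey_property_one by blast
next
  case (step k)
  then show ?case
    using boolean_ramsey_property_add[OF _ boolean_ramsey_property_one, of k m] by auto
qed

lemma boolean_ramsey_property_boolean_ramsey:
  assumes "k \<ge> 1"
  shows "boolean_ramsey_property k m (boolean_ramsey k m)"
  unfolding boolean_ramsey_def
  using boolean_ramsey_property_ex[OF assms] by (metis LeastI)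

text \<open>Colouring by blocks of \<open>m\<close> consecutive levels leaves no monochromatic chain of \<open>m + 1\<close> sets.\<close>

lemma boolean_ramsey_property_lower_bound:
  assumes "boolean_ramsey_property k m N" "m \<ge> 1"
  shows "k * m \<le> N"
proof (rule ccontr)
  assume "\<not> k * m \<le> N"
  define c :: "nat set \<Rightarrow> nat" where "c S = Suc (card S div m)" for S
  have "c S \<in> {1..k}" if "S \<subseteq> {1..N}" for S
  proof -
    have "card S < k * m"
      using card_mono[OF _ that] \<open>\<not> k * m \<le> N\<close> by simp
    then show ?thesis
      using assms(2) by (simp add: c_def less_mult_imp_div_less Suc_le_eq)
  qed
  then have "c ` Pow {1..N} \<subseteq> {1..k}"
    by blast
  with assms(1) have "mono_copy c m {1..N}"
    unfolding boolean_ramsey_property_iff by simp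
  then obtain f i where "\<forall>x\<in>boolean_lattice m. f x \<subseteq> {1..N} \<and> c (f x) = i"
    "\<forall>x\<in>boolean_lattice m. \<forall>y\<in>boolean_lattice m. f x \<subseteq> f y \<longleftrightarrow> x \<subseteq> y"
    unfolding mono_copy_def by blast
  then have f: "\<And>x. x \<in> boolean_lattice m \<Longrightarrow> f x \<subseteq> {1..N} \<and> c (f x) = i"
    "\<And>x y. x \<in> boolean_lattice m \<Longrightarrow> y \<in> boolean_lattice m \<Longrightarrow> f x \<subseteq> f y \<longleftrightarrow> x \<subseteq> y"
    by simp_all
  have chain: "{1..j} \<in> boolean_lattice m" if "j \<le> m" for j
    using that by (auto simp: boolean_lattice_def)
  have "card (f {1..0}) + j \<le> card (f {1..j})" if "j \<le> m" for j
    using that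
  proof (induction j)
    case (Suc j)
    have "f {1..j} \<subset> f {1..Suc j}"
      using f(2)[of "{1..j}" "{1..Suc j}"] f(2)[of "{1..Suc j}" "{1..j}"] chain Suc.prems by auto
    moreover have "finite (f {1..Suc j})"
      using f(1)[OF chain[OF Suc.prems]] finite_subset by blast
    ultimately have "card (f {1..j}) < card (f {1..Suc j})"
      by (rule psubset_card_mono[rotated])
    with Suc show ?case
      by simp
  qed simp
  from this[of m] have "card (f {1..0}) + m \<le> card (f {1..m})"
    by simp
  \<comment> \<open>Adding \<open>m\<close> raises the quotient by one, so bottom and top of the
    copy cannot share a colour.\<close>
  then have "(card (f {1..0}) + m) div m \<le> card (f {1..m}) div m"
    by (rule div_le_mono)
  moreover have "c (f {1..0}) = c (f {1..m})"
    using f(1)[OF chain[of 0]] f(1)[OF chain[of m]] by simp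
  ultimately show False
    using assms(2) by (simp add: c_def)
qed

section \<open>Saving three levels\<close>

text \<open>The classes for \<open>p\<close> in \<open>K - P\<close> cover \<open>W\<close>: points
  coloured by \<open>P\<close> lie in all of them, and there is at least one
  \<open>p\<close>.\<close>

lemma ex_colour_pigeonhole:
  fixes g :: "'a \<Rightarrow> 'c"
  assumes W: "finite W" "g ` W \<subseteq> K" and K: "finite K" "P \<subset> K"
    and large: "card (K - P) * n < card W"
  shows "\<exists>p\<in>K - P. n < card {x\<in>W. g x \<in> insert p P}"
proof (rule ccontr)
  assume "\<not> ?thesis"
  then have le: "card {x\<in>W. g x \<in> insert p P} \<le> n" if "p \<in> K - P" for p
    using that by (meson not_le)
  have "W \<subseteq> (\<Union>p\<in>K - P. {x\<in>W. g x \<in> insert p P})"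
    using W(2) K(2) by blast
  then have "card W \<le> card (\<Union>p\<in>K - P. {x\<in>W. g x \<in> insert p P})"
    using W(1) K(1) by (intro card_mono) auto
  also have "\<dots> \<le> (\<Sum>p\<in>K - P. card {x\<in>W. g x \<in> insert p P})"
    using K(1) by (intro card_UN_le) auto
  also have "\<dots> \<le> card (K - P) * n"
    using sum_bounded_above[of "K - P" _ n] le by simp
  finally show False
    using large by simp
qed

lemma boolean_ramsey_property_add_three_free_levels:
  assumes ramsey: "boolean_ramsey_property a m A" "boolean_ramsey_property b m B"
    and a: "a \<ge> 3" and A: "A \<ge> 3" and large: "(a + b - 2) * (A - 1) < (A - 2) * B + A"
  shows "boolean_ramsey_property (a + b) m ((A - 2) * B + A)"
  unfolding boolean_ramsey_property_iff
proof (intro allI impI)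
  fix c :: "nat set \<Rightarrow> nat"
  let ?N = "(A - 2) * B + A" and ?K = "{1..a + b}"
  let ?W = "{1..?N}"
  assume c: "c ` Pow ?W \<subseteq> ?K"
  have K: "finite ?K" "card ?K = a + b"
    by simp_all
  have "card {c {}, c ?W} \<le> 2"
    by (simp add: card_insert_if)
  moreover have "2 \<le> card ?K"
    using a by simp
  moreover have "{c {}, c ?W} \<subseteq> ?K"
    using c by blast
  \<comment> \<open>The empty set and the full set may share a colour; padding to exactly two
    colours fixes the count of \<open>?K - P\<close>.\<close>
  ultimately obtain P where P: "{c {}, c ?W} \<subseteq> P" "P \<subseteq> ?K" "card P = 2"
    using exists_subset_between K(1) by metis
  have "card (?K - P) = a + b - 2"
    using P by (simp add: card_Diff_subset finite_subset)
  then have pigeons: "card (?K - P) * (A - 1) < card ?W"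
    using large by simp
  have "P \<subset> ?K"
    using P(2,3) K(2) a by (intro psubsetI) auto
  moreover have "(\<lambda>x. c {x}) ` ?W \<subseteq> ?K"
    using c by blast
  ultimately have "\<exists>p\<in>?K - P. A - 1 < card {x\<in>?W. c {x} \<in> insert p P}"
    by (intro ex_colour_pigeonhole pigeons) simp_all
  then obtain p where p: "p \<in> ?K - P" "A - 1 < card {x\<in>?W. c {x} \<in> insert p P}"
    by (elim bexE)
  then have "A \<le> card {x\<in>?W. c {x} \<in> insert p P}"
    by linarith
  then obtain X where X: "X \<subseteq> {x\<in>?W. c {x} \<in> insert p P}" "card X = A" "finite X"
    by (rule obtain_subset_with_card_n)
  have "card (insert p P) \<le> a"
    using P(3) p(1) finite_subset[OF P(2)] a by simp
  moreover have "a \<le> card ?K"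
    by simp
  moreover have "insert p P \<subseteq> ?K"
    using P(2) p(1) by blast
  \<comment> \<open>Padding to exactly \<open>a\<close> colours leaves \<open>b\<close> for the
    complement.\<close>
  ultimately obtain K1 where K1: "insert p P \<subseteq> K1" "K1 \<subseteq> ?K" "card K1 = a"
    using exists_subset_between K(1) by metis
  define Z where "Z = ?W - X"
  have W: "X \<union> Z = ?W"
    using X(1) by (auto simp: Z_def)
  have "card Z = (A - 2) * B"
    using X(2,3) card_Diff_subset[OF X(3), of ?W] W unfolding Z_def by auto
  then obtain e where e: "bij_betw e {0..<(A - 2) * B} Z"
    using ex_bij_betw_nat_finite[of Z] by (auto simp: Z_def)
  \<comment> \<open>Truncated subtraction makes \<open>F 0\<close>, \<open>F 1\<close> and
    \<open>F 2\<close> empty, and \<open>min\<close> stops the growth at \<open>F A = Z\<close>.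
    Thus exactly the levels from 2 to \<open>A - 1\<close> get a block.\<close>
  define F where "F i = e ` {0..<(min i A - 2) * B}" for i
  have F_sub: "(min i A - 2) * B \<le> (A - 2) * B" for i
    by (intro mult_right_mono) auto
  have "mono_copy c m (X \<union> Z)"
  proof (rule mono_copy_filtration[OF ramsey X(3,2), where ?F = F])
    show "finite K1"
      using K1(2) finite_subset by blast
    then show "card (?K - K1) \<le> b"
      using K1 by (simp add: card_Diff_subset)
    show "c ` Pow (X \<union> Z) \<subseteq> K1 \<union> (?K - K1)"
      using c unfolding W by blast
    show "mono F"
      unfolding F_def
      by (intro monoI image_mono ivl_subset[THEN iffD2] disjI2 conjI mult_right_mono) auto
    show "F i \<subseteq> Z" for i
      unfolding F_def bij_betw_imp_surj_on[OF e, symmetric] using F_sub[of i]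
      by (intro image_mono) simp
    show "B \<le> card (F (Suc (card S)) - F (card S)) \<or> c (S \<union> F (card S)) \<in> K1"
      if S: "S \<subseteq> X" for S
    proof -
      have "card S \<le> A"
        using card_mono[OF X(3) S] X(2) by simp
      then consider "card S = 0" | "card S = 1" | "2 \<le> card S" "card S < A" | "card S = A"
        by linarith
      then show ?thesis
      proof cases
        case 1
        then have "S = {}"
          using S X(3) finite_subset by fastforce
        then show ?thesis
          using subsetD[OF K1(1), of "c {}"] P(1) by (simp add: F_def)
      next
        case 2
        then obtain x where "S = {x}"
          using card_1_singletonE by blast
        then show ?thesis
          using X(1) S subsetD[OF K1(1), of "c {x}"] by (simp add: F_def subset_iff)
      next
        case 3
        then have "min (Suc (card S)) A - 2 = Suc (min (card S) A - 2)"
          by linarith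
        then have eq: "(min (Suc (card S)) A - 2) * B = (min (card S) A - 2) * B + B"
          by (simp only: mult_Suc add.commute)
        have inj: "inj_on e {0..<(min i A - 2) * B}" for i
          using e F_sub[of i] unfolding bij_betw_def by (meson inj_on_subset ivl_subset order_refl)
        have card_F: "card (F i) = (min i A - 2) * B" for i
          using card_image[OF inj] by (simp add: F_def)
        have "card (F (Suc (card S))) - card (F (card S)) \<le> card (F (Suc (card S)) - F (card S))"
          by (rule diff_card_le_card_Diff) (simp add: F_def)
        then show ?thesis
          unfolding card_F eq by simp
      next
        case 4
        then have "S = X"
          using card_subset_eq[OF X(3) S] X(2) by simp
        moreover have "F (card S) = Z"
          using 4 e by (simp add: F_def bij_betw_def)
        ultimately show ?thesis
          using W subsetD[OF K1(1), of "c ?W"] P(1) by simp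
      qed
    qed
  qed (auto simp: Z_def K1(3))
  then show "mono_copy c m ?W"
    unfolding W .
qed

section \<open>Applying the estimate to the two halves of the colours\<close>

theorem theorem5p1:
  fixes k m :: nat
  assumes "k \<ge> 6" and "m \<ge> 2"
  shows "int (boolean_ramsey k m)
    \<le> (int (boolean_ramsey (nat \<lfloor>real k / 2\<rfloor>) m) - 2) * int (boolean_ramsey (nat \<lceil>real k / 2\<rceil>) m)
      + int (boolean_ramsey (nat \<lfloor>real k / 2\<rfloor>) m)"
proof -
  define a b where "a = nat \<lfloor>real k / 2\<rfloor>" and "b = nat \<lceil>real k / 2\<rceil>"
  have ab: "a + b = k" "a \<le> b" "b \<le> a + 1"
    unfolding a_def b_def by linarith+
  have a3: "a \<ge> 3" and b1: "b \<ge> 1"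
    using ab assms(1) by linarith+
  define A B where "A = boolean_ramsey a m" and "B = boolean_ramsey b m"
  have ramsey: "boolean_ramsey_property a m A" "boolean_ramsey_property b m B"
    unfolding A_def B_def using boolean_ramsey_property_boolean_ramsey a3 b1 by simp_all
  have "a * m \<le> A" "b * m \<le> B"
    using boolean_ramsey_property_lower_bound ramsey assms(2) by simp_all
  moreover have "a * 2 \<le> a * m" "b * 2 \<le> b * m"
    using assms(2) by simp_all
  ultimately have lower: "2 * a \<le> A" "2 * b \<le> B"
    by linarith+
  \<comment> \<open>The pigeonhole condition: \<open>k - 2\<close> is at most \<open>2 * b\<close>,
    hence at most \<open>B\<close>, and \<open>k - 2 < 2 * a\<close>, hence below
    \<open>A\<close>.\<close>
  have "A - 1 = Suc (A - 2)"
    using lower(1) a3 by linarith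
  then have "(k - 2) * (A - 1) = (k - 2) * (A - 2) + (k - 2)"
    by simp
  also have "\<dots> < (A - 2) * B + A"
  proof (rule add_le_less_mono)
    show "(k - 2) * (A - 2) \<le> (A - 2) * B"
      using lower(2) ab by (subst mult.commute) (intro mult_left_mono, auto)
    show "k - 2 < A"
      using lower(1) ab a3 by linarith
  qed
  finally have "boolean_ramsey_property (a + b) m ((A - 2) * B + A)"
    using boolean_ramsey_property_add_three_free_levels[OF ramsey a3] lower(1) a3 ab(1) by simp
  then have "boolean_ramsey k m \<le> (A - 2) * B + A"
    unfolding boolean_ramsey_def ab(1) by (rule Least_le)
  then have "int (boolean_ramsey k m) \<le> int ((A - 2) * B + A)"
    by linarith
  \<comment> \<open>As \<open>A\<close> is at least 6, the natural subtraction does not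
    truncate.\<close>
  also have "\<dots> = (int A - 2) * int B + int A"
    using lower(1) a3 by (simp add: of_nat_diff)
  finally show ?thesis
    unfolding A_def B_def a_def b_def .
qed

end
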